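(* Let $(I,\alpha)$ be a unit object in a semi-monoidal 2-category $\mathcal{C}$. The 2-cell $A:I\alpha\Rightarrow\alpha I$ defined, from a left constraint $(\lambda,L)$ and a right constraint $(\rho,R)$ for $(I,\alpha)$, as the unique 2-cell satisfying $$(IL_I^{-1}\,\#\,R_I)\bullet(R_I^{-1}I\,\#\,L_I)=I\alpha I\,\#\,A$$ (where the left-hand side is the composite $I\alpha I\# I\alpha\Rightarrow II\lambda_I\#\rho_I I=\rho_I II\# I\lambda_I\Rightarrow I\alpha I\#\alpha I$) does not depend on the choices of $(\lambda,L)$ and $(\rho,R)$.
   Context: A semi-monoidal 2-category $\mathcal{C}$ is a strict 2-category with a strict 2-functor $\mathcal{C}\times\mathcal{C}\to\mathcal{C}$, $(X,Y)\mapsto XY$ (tensor product, written by juxtaposition), strictly associative. No unit is assumed. $\#$ denotes composition of arrows and horizontal composition of 2-cells (including whiskering), written left to right; $\bullet$ denotes vertical composition of 2-cells, also left to right. The name of an object (arrow) also denotes its identity arrow (identity 2-cell). An equi-arrow is an arrow admitting a pseudo-inverse. An object $I$ is cancellable if $X\mapsto IX$ and $X\mapsto XI$ are fully faithful 2-functors, i.e. induce equivalences on hom categories. A unit object is a pair $(I,\alpha)$ with $I$ cancellable and $\alpha: II\to I$ an equi-arrow. A left constraint for $(I,\alpha)$ consists, for each object $X$, of an equi-arrow $\lambda_X:IX\to X$ and an invertible 2-cell $L_X:I\lambda_X\Rightarrow\alpha X$; a right constraint consists, for each $X$, of an equi-arrow $\rho_X:XI\to X$ and an invertible 2-cell $R_X:X\alpha\Rightarrow\rho_XI$.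 Since $I\alpha I$ is an equi-arrow, whiskering with it is bijective on 2-cells, so $A$ is well defined by the displayed equation for each choice. *)

theory Defs
  imports Main
begin

text \<open>
  All compositions are written in diagrammatic order (left to right).  Operations are total
  functions on the underlying types, constrained only on the composable elements of the carriers.
\<close>

section \<open>Categories, functors, equivalences of categories\<close>

record ('o, 'm) cat =
  Ob :: "'o set"
  Mor :: "'m set"
  Dom :: "'m \<Rightarrow> 'o"
  Cod :: "'m \<Rightarrow> 'o"
  Ident :: "'o \<Rightarrow> 'm"
  Comp :: "'m \<Rightarrow> 'm \<Rightarrow> 'm"

locale category =
  fixes K :: "('o, 'm) cat"
  assumes Dom_in: "m \<in> Mor K \<Longrightarrow> Dom K m \<in> Ob K"
    and Cod_in: "m \<in> Mor K \<Longrightarrow> Cod K m \<in> Ob K"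
    and Ident_in: "X \<in> Ob K \<Longrightarrow> Ident K X \<in> Mor K"
    and Dom_Ident: "X \<in> Ob K \<Longrightarrow> Dom K (Ident K X) = X"
    and Cod_Ident: "X \<in> Ob K \<Longrightarrow> Cod K (Ident K X) = X"
    and Comp_in: "\<lbrakk>m \<in> Mor K; n \<in> Mor K; Cod K m = Dom K n\<rbrakk> \<Longrightarrow> Comp K m n \<in> Mor K"
    and Dom_Comp: "\<lbrakk>m \<in> Mor K; n \<in> Mor K; Cod K m = Dom K n\<rbrakk> \<Longrightarrow> Dom K (Comp K m n) = Dom K m"
    and Cod_Comp: "\<lbrakk>m \<in> Mor K; n \<in> Mor K; Cod K m = Dom K n\<rbrakk> \<Longrightarrow> Cod K (Comp K m n) = Cod K n"
    and Comp_Ident_left: "m \<in> Mor K \<Longrightarrow> Comp K (Ident K (Dom K m)) m = m"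
    and Comp_Ident_right: "m \<in> Mor K \<Longrightarrow> Comp K m (Ident K (Cod K m)) = m"
    and Comp_assoc: "\<lbrakk>m \<in> Mor K; n \<in> Mor K; p \<in> Mor K; Cod K m = Dom K n; Cod K n = Dom K p\<rbrakk>
      \<Longrightarrow> Comp K (Comp K m n) p = Comp K m (Comp K n p)"

definition inverse_mor :: "('o, 'm) cat \<Rightarrow> 'm \<Rightarrow> 'm \<Rightarrow> bool" where
  "inverse_mor K m n \<longleftrightarrow> m \<in> Mor K \<and> n \<in> Mor K \<and> Dom K n = Cod K m \<and> Cod K n = Dom K m \<and>
     Comp K m n = Ident K (Dom K m) \<and> Comp K n m = Ident K (Cod K m)"

definition iso_mor :: "('o, 'm) cat \<Rightarrow> 'm \<Rightarrow> bool" where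
  "iso_mor K m \<longleftrightarrow> (\<exists>n. inverse_mor K m n)"

locale is_functor =
  fixes K :: "('o, 'm) cat" and K' :: "('p, 'n) cat"
    and Fo :: "'o \<Rightarrow> 'p" and Fm :: "'m \<Rightarrow> 'n"
  assumes Fo_in: "X \<in> Ob K \<Longrightarrow> Fo X \<in> Ob K'"
    and Fm_in: "m \<in> Mor K \<Longrightarrow> Fm m \<in> Mor K'"
    and Dom_Fm: "m \<in> Mor K \<Longrightarrow> Dom K' (Fm m) = Fo (Dom K m)"
    and Cod_Fm: "m \<in> Mor K \<Longrightarrow> Cod K' (Fm m) = Fo (Cod K m)"
    and Fm_Ident: "X \<in> Ob K \<Longrightarrow> Fm (Ident K X) = Ident K' (Fo X)"
    and Fm_Comp: "\<lbrakk>m \<in> Mor K; n \<in> Mor K; Cod K m = Dom K n\<rbrakk>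
      \<Longrightarrow> Fm (Comp K m n) = Comp K' (Fm m) (Fm n)"

definition natural_iso ::
  "('o, 'm) cat \<Rightarrow> ('p, 'n) cat \<Rightarrow> ('o \<Rightarrow> 'p) \<Rightarrow> ('m \<Rightarrow> 'n) \<Rightarrow> ('o \<Rightarrow> 'p) \<Rightarrow> ('m \<Rightarrow> 'n) \<Rightarrow> ('o \<Rightarrow> 'n) \<Rightarrow> bool"
  where
  "natural_iso K K' Fo Fm Go Gm t \<longleftrightarrow>
     (\<forall>X\<in>Ob K. iso_mor K' (t X) \<and> Dom K' (t X) = Fo X \<and> Cod K' (t X) = Go X) \<and>
     (\<forall>m\<in>Mor K. Comp K' (Fm m) (t (Cod K m)) = Comp K' (t (Dom K m)) (Gm m))"

definition equivalence ::
  "('o, 'm) cat \<Rightarrow> ('p, 'n) cat \<Rightarrow> ('o \<Rightarrow> 'p) \<Rightarrow> ('m \<Rightarrow> 'n) \<Rightarrow> bool" where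
  "equivalence K K' Fo Fm \<longleftrightarrow> is_functor K K' Fo Fm \<and>
     (\<exists>Go Gm \<eta> \<epsilon>. is_functor K' K Go Gm \<and>
        natural_iso K K id id (Go \<circ> Fo) (Gm \<circ> Fm) \<eta> \<and>
        natural_iso K' K' (Fo \<circ> Go) (Fm \<circ> Gm) id id \<epsilon>)"


section \<open>Strict 2-categories and strict 2-functors\<close>

record ('o, 'a, 'c) two_cat =
  Obj :: "'o set"
  Arr :: "'a set"
  Cell :: "'c set"
  src :: "'a \<Rightarrow> 'o"
  tgt :: "'a \<Rightarrow> 'o"
  csrc :: "'c \<Rightarrow> 'a"
  ctgt :: "'c \<Rightarrow> 'a"
  id_arr :: "'o \<Rightarrow> 'a" ("\<one>\<index>")
  id_cell :: "'a \<Rightarrow> 'c" ("\<iota>\<index>")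
  acomp :: "'a \<Rightarrow> 'a \<Rightarrow> 'a" (infixl "\<odot>\<index>" 60)
  hcomp :: "'c \<Rightarrow> 'c \<Rightarrow> 'c" (infixl "\<star>\<index>" 60)
  vcomp :: "'c \<Rightarrow> 'c \<Rightarrow> 'c" (infixl "\<bullet>\<index>" 55)

definition arrow_cat :: "('o, 'a, 'c, 'e) two_cat_scheme \<Rightarrow> ('o, 'a) cat" where
  "arrow_cat C = \<lparr>Ob = Obj C, Mor = Arr C, Dom = src C, Cod = tgt C,
     Ident = id_arr C, Comp = acomp C\<rparr>"

text \<open>The disjoint union of all the hom categories.\<close>
definition vertical_cat :: "('o, 'a, 'c, 'e) two_cat_scheme \<Rightarrow> ('a, 'c) cat" where
  "vertical_cat C = \<lparr>Ob = Arr C, Mor = Cell C, Dom = csrc C, Cod = ctgt C,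
     Ident = id_cell C, Comp = vcomp C\<rparr>"

definition horizontal_cat :: "('o, 'a, 'c, 'e) two_cat_scheme \<Rightarrow> ('o, 'c) cat" where
  "horizontal_cat C = \<lparr>Ob = Obj C, Mor = Cell C, Dom = src C \<circ> csrc C, Cod = tgt C \<circ> csrc C,
     Ident = id_cell C \<circ> id_arr C, Comp = hcomp C\<rparr>"

locale strict_2_category =
  fixes C :: "('o, 'a, 'c, 'e) two_cat_scheme" (structure)
  assumes arrow_category: "category (arrow_cat C)"
    and vertical_category: "category (vertical_cat C)"
    and horizontal_category: "category (horizontal_cat C)"
    and src_ctgt: "a \<in> Cell C \<Longrightarrow> src C (ctgt C a) = src C (csrc C a)"
    and tgt_ctgt: "a \<in> Cell C \<Longrightarrow> tgt C (ctgt C a) = tgt C (csrc C a)"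
    and csrc_hcomp: "\<lbrakk>a \<in> Cell C; b \<in> Cell C; tgt C (csrc C a) = src C (csrc C b)\<rbrakk>
      \<Longrightarrow> csrc C (a \<star> b) = csrc C a \<odot> csrc C b"
    and ctgt_hcomp: "\<lbrakk>a \<in> Cell C; b \<in> Cell C; tgt C (csrc C a) = src C (csrc C b)\<rbrakk>
      \<Longrightarrow> ctgt C (a \<star> b) = ctgt C a \<odot> ctgt C b"
    and id_cell_acomp: "\<lbrakk>f \<in> Arr C; g \<in> Arr C; tgt C f = src C g\<rbrakk> \<Longrightarrow> \<iota> (f \<odot> g) = \<iota> f \<star> \<iota> g"
    and interchange: "\<lbrakk>a \<in> Cell C; a' \<in> Cell C; b \<in> Cell C; b' \<in> Cell C;
        ctgt C a = csrc C a'; ctgt C b = csrc C b'; tgt C (csrc C a) = src C (csrc C b)\<rbrakk>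
      \<Longrightarrow> (a \<bullet> a') \<star> (b \<bullet> b') = (a \<star> b) \<bullet> (a' \<star> b')"

definition hom :: "('o, 'a, 'c, 'e) two_cat_scheme \<Rightarrow> 'o \<Rightarrow> 'o \<Rightarrow> 'a set" where
  "hom C X Y = {f \<in> Arr C. src C f = X \<and> tgt C f = Y}"

definition cells :: "('o, 'a, 'c, 'e) two_cat_scheme \<Rightarrow> 'a \<Rightarrow> 'a \<Rightarrow> 'c set" where
  "cells C f g = {a \<in> Cell C. csrc C a = f \<and> ctgt C a = g}"

definition hom_cat :: "('o, 'a, 'c, 'e) two_cat_scheme \<Rightarrow> 'o \<Rightarrow> 'o \<Rightarrow> ('a, 'c) cat" where
  "hom_cat C X Y = (vertical_cat C)
     \<lparr>Ob := hom C X Y, Mor := {a \<in> Cell C. csrc C a \<in> hom C X Y \<and> ctgt C a \<in> hom C X Y}\<rparr>"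

definition invertible_cell :: "('o, 'a, 'c, 'e) two_cat_scheme \<Rightarrow> 'c \<Rightarrow> bool" where
  "invertible_cell C a \<longleftrightarrow> iso_mor (vertical_cat C) a"

definition inv_cell :: "('o, 'a, 'c, 'e) two_cat_scheme \<Rightarrow> 'c \<Rightarrow> 'c" where
  "inv_cell C a = (THE b. inverse_mor (vertical_cat C) a b)"

definition equi_arrow :: "('o, 'a, 'c, 'e) two_cat_scheme \<Rightarrow> 'a \<Rightarrow> bool" where
  "equi_arrow C f \<longleftrightarrow> f \<in> Arr C \<and>
     (\<exists>g \<in> hom C (tgt C f) (src C f).
        (\<exists>a \<in> cells C (f \<odot>\<^bsub>C\<^esub> g) (\<one>\<^bsub>C\<^esub> (src C f)). invertible_cell C a) \<and>
        (\<exists>b \<in> cells C (g \<odot>\<^bsub>C\<^esub> f) (\<one>\<^bsub>C\<^esub> (tgt C f)). invertible_cell C b))"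

definition prod_2_cat ::
  "('o, 'a, 'c, 'e) two_cat_scheme \<Rightarrow> ('p, 'b, 'd, 'f) two_cat_scheme \<Rightarrow> ('o \<times> 'p, 'a \<times> 'b, 'c \<times> 'd) two_cat"
  where
  "prod_2_cat C D =
    \<lparr>Obj = Obj C \<times> Obj D, Arr = Arr C \<times> Arr D, Cell = Cell C \<times> Cell D,
     src = map_prod (src C) (src D), tgt = map_prod (tgt C) (tgt D),
     csrc = map_prod (csrc C) (csrc D), ctgt = map_prod (ctgt C) (ctgt D),
     id_arr = map_prod (id_arr C) (id_arr D), id_cell = map_prod (id_cell C) (id_cell D),
     acomp = (\<lambda>(f, g) (f', g'). (f \<odot>\<^bsub>C\<^esub> f', g \<odot>\<^bsub>D\<^esub> g')),
     hcomp = (\<lambda>(a, b) (a', b'). (a \<star>\<^bsub>C\<^esub> a', b \<star>\<^bsub>D\<^esub> b')),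
     vcomp = (\<lambda>(a, b) (a', b'). (a \<bullet>\<^bsub>C\<^esub> a', b \<bullet>\<^bsub>D\<^esub> b'))\<rparr>"

definition strict_2_functor ::
  "('o, 'a, 'c, 'e) two_cat_scheme \<Rightarrow> ('p, 'b, 'd, 'f) two_cat_scheme
     \<Rightarrow> ('o \<Rightarrow> 'p) \<Rightarrow> ('a \<Rightarrow> 'b) \<Rightarrow> ('c \<Rightarrow> 'd) \<Rightarrow> bool" where
  "strict_2_functor C D Fo Fa Fc \<longleftrightarrow>
     is_functor (arrow_cat C) (arrow_cat D) Fo Fa \<and>
     is_functor (vertical_cat C) (vertical_cat D) Fa Fc \<and>
     is_functor (horizontal_cat C) (horizontal_cat D) Fo Fc"

definition fully_faithful_2_functor ::
  "('o, 'a, 'c, 'e) two_cat_scheme \<Rightarrow> ('p, 'b, 'd, 'f) two_cat_scheme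
     \<Rightarrow> ('o \<Rightarrow> 'p) \<Rightarrow> ('a \<Rightarrow> 'b) \<Rightarrow> ('c \<Rightarrow> 'd) \<Rightarrow> bool" where
  "fully_faithful_2_functor C D Fo Fa Fc \<longleftrightarrow> strict_2_functor C D Fo Fa Fc \<and>
     (\<forall>X\<in>Obj C. \<forall>Y\<in>Obj C. equivalence (hom_cat C X Y) (hom_cat D (Fo X) (Fo Y)) Fa Fc)"


section \<open>Semi-monoidal 2-categories and units\<close>

record ('o, 'a, 'c) semi_monoidal = "('o, 'a, 'c) two_cat" +
  tensor_obj :: "'o \<Rightarrow> 'o \<Rightarrow> 'o" (infixl "\<otimes>\<^sub>o\<index>" 70)
  tensor_arr :: "'a \<Rightarrow> 'a \<Rightarrow> 'a" (infixl "\<otimes>\<^sub>a\<index>" 70)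
  tensor_cell :: "'c \<Rightarrow> 'c \<Rightarrow> 'c" (infixl "\<otimes>\<^sub>c\<index>" 70)

locale semi_monoidal_2_category = strict_2_category C
  for C :: "('o, 'a, 'c, 'e) semi_monoidal_scheme" (structure) +
  assumes tensor_2_functor: "strict_2_functor (prod_2_cat C C) C
      (\<lambda>(X, Y). X \<otimes>\<^sub>o Y) (\<lambda>(f, g). f \<otimes>\<^sub>a g) (\<lambda>(a, b). a \<otimes>\<^sub>c b)"
    and tensor_obj_assoc: "\<lbrakk>X \<in> Obj C; Y \<in> Obj C; Z \<in> Obj C\<rbrakk>
      \<Longrightarrow> (X \<otimes>\<^sub>o Y) \<otimes>\<^sub>o Z = X \<otimes>\<^sub>o (Y \<otimes>\<^sub>o Z)"
    and tensor_arr_assoc: "\<lbrakk>f \<in> Arr C; g \<in> Arr C; h \<in> Arr C\<rbrakk>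
      \<Longrightarrow> (f \<otimes>\<^sub>a g) \<otimes>\<^sub>a h = f \<otimes>\<^sub>a (g \<otimes>\<^sub>a h)"
    and tensor_cell_assoc: "\<lbrakk>a \<in> Cell C; b \<in> Cell C; c \<in> Cell C\<rbrakk>
      \<Longrightarrow> (a \<otimes>\<^sub>c b) \<otimes>\<^sub>c c = a \<otimes>\<^sub>c (b \<otimes>\<^sub>c c)"

text \<open>Tensoring an arrow or a 2-cell with an object means tensoring with its identity arrow
  or with the identity 2-cell on that arrow.\<close>
definition cancellable :: "('o, 'a, 'c, 'e) semi_monoidal_scheme \<Rightarrow> 'o \<Rightarrow> bool" where
  "cancellable C I \<longleftrightarrow> I \<in> Obj C \<and>
     fully_faithful_2_functor C C (\<lambda>X. I \<otimes>\<^sub>o\<^bsub>C\<^esub> X)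
       (\<lambda>f. \<one>\<^bsub>C\<^esub> I \<otimes>\<^sub>a\<^bsub>C\<^esub> f) (\<lambda>a. \<iota>\<^bsub>C\<^esub> (\<one>\<^bsub>C\<^esub> I) \<otimes>\<^sub>c\<^bsub>C\<^esub> a) \<and>
     fully_faithful_2_functor C C (\<lambda>X. X \<otimes>\<^sub>o\<^bsub>C\<^esub> I)
       (\<lambda>f. f \<otimes>\<^sub>a\<^bsub>C\<^esub> \<one>\<^bsub>C\<^esub> I) (\<lambda>a. a \<otimes>\<^sub>c\<^bsub>C\<^esub> \<iota>\<^bsub>C\<^esub> (\<one>\<^bsub>C\<^esub> I))"

definition unit_object :: "('o, 'a, 'c, 'e) semi_monoidal_scheme \<Rightarrow> 'o \<Rightarrow> 'a \<Rightarrow> bool" where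
  "unit_object C I \<alpha> \<longleftrightarrow> cancellable C I \<and> \<alpha> \<in> hom C (I \<otimes>\<^sub>o\<^bsub>C\<^esub> I) I \<and> equi_arrow C \<alpha>"

definition left_constraint ::
  "('o, 'a, 'c, 'e) semi_monoidal_scheme \<Rightarrow> 'o \<Rightarrow> 'a \<Rightarrow> ('o \<Rightarrow> 'a) \<Rightarrow> ('o \<Rightarrow> 'c) \<Rightarrow> bool" where
  "left_constraint C I \<alpha> lam L \<longleftrightarrow> (\<forall>X\<in>Obj C.
     lam X \<in> hom C (I \<otimes>\<^sub>o\<^bsub>C\<^esub> X) X \<and> equi_arrow C (lam X) \<and>
     L X \<in> cells C (\<one>\<^bsub>C\<^esub> I \<otimes>\<^sub>a\<^bsub>C\<^esub> lam X) (\<alpha> \<otimes>\<^sub>a\<^bsub>C\<^esub> \<one>\<^bsub>C\<^esub> X) \<and> invertible_cell C (L X))"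

definition right_constraint ::
  "('o, 'a, 'c, 'e) semi_monoidal_scheme \<Rightarrow> 'o \<Rightarrow> 'a \<Rightarrow> ('o \<Rightarrow> 'a) \<Rightarrow> ('o \<Rightarrow> 'c) \<Rightarrow> bool" where
  "right_constraint C I \<alpha> rho R \<longleftrightarrow> (\<forall>X\<in>Obj C.
     rho X \<in> hom C (X \<otimes>\<^sub>o\<^bsub>C\<^esub> I) X \<and> equi_arrow C (rho X) \<and>
     R X \<in> cells C (\<one>\<^bsub>C\<^esub> X \<otimes>\<^sub>a\<^bsub>C\<^esub> \<alpha>) (rho X \<otimes>\<^sub>a\<^bsub>C\<^esub> \<one>\<^bsub>C\<^esub> I) \<and> invertible_cell C (R X))"

text \<open>\<open>A : I\<alpha> \<Rightarrow> \<alpha>I\<close> with \<open>(I L\<^sub>I\<^sup>-\<^sup>1 # R\<^sub>I) \<bullet> (R\<^sub>I\<^sup>-\<^sup>1 I # L\<^sub>I) = I\<alpha>I # A\<close>.\<close>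
definition associator_eq ::
  "('o, 'a, 'c, 'e) semi_monoidal_scheme \<Rightarrow> 'o \<Rightarrow> 'a \<Rightarrow> ('o \<Rightarrow> 'c) \<Rightarrow> ('o \<Rightarrow> 'c) \<Rightarrow> 'c \<Rightarrow> bool" where
  "associator_eq C I \<alpha> L R A \<longleftrightarrow>
     A \<in> cells C (\<one>\<^bsub>C\<^esub> I \<otimes>\<^sub>a\<^bsub>C\<^esub> \<alpha>) (\<alpha> \<otimes>\<^sub>a\<^bsub>C\<^esub> \<one>\<^bsub>C\<^esub> I) \<and>
     ((\<iota>\<^bsub>C\<^esub> (\<one>\<^bsub>C\<^esub> I) \<otimes>\<^sub>c\<^bsub>C\<^esub> inv_cell C (L I)) \<star>\<^bsub>C\<^esub> R I)
       \<bullet>\<^bsub>C\<^esub> ((inv_cell C (R I) \<otimes>\<^sub>c\<^bsub>C\<^esub> \<iota>\<^bsub>C\<^esub> (\<one>\<^bsub>C\<^esub> I)) \<star>\<^bsub>C\<^esub> L I)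
     = \<iota>\<^bsub>C\<^esub> (\<one>\<^bsub>C\<^esub> I \<otimes>\<^sub>a\<^bsub>C\<^esub> \<alpha> \<otimes>\<^sub>a\<^bsub>C\<^esub> \<one>\<^bsub>C\<^esub> I) \<star>\<^bsub>C\<^esub> A"

definition associator ::
  "('o, 'a, 'c, 'e) semi_monoidal_scheme \<Rightarrow> 'o \<Rightarrow> 'a \<Rightarrow> ('o \<Rightarrow> 'c) \<Rightarrow> ('o \<Rightarrow> 'c) \<Rightarrow> 'c" where
  "associator C I \<alpha> L R = (THE A. associator_eq C I \<alpha> L R A)"

end

theory Submission
  imports Defs
begin

text \<open>
  As \<open>I\<close> is cancellable, two left constraints at \<open>I\<close> are linked by a 2-cell
  \<open>U : \<lambda>\<^sub>I \<Rightarrow> \<lambda>'\<^sub>I\<close> with \<open>L\<^sub>I = IU \<bullet> L'\<^sub>I\<close>, and two right constraints by a 2-cell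
  \<open>V : \<rho>\<^sub>I \<Rightarrow> \<rho>'\<^sub>I\<close> with \<open>R'\<^sub>I = R\<^sub>I \<bullet> VI\<close>.  Inserting \<open>U\<close> and \<open>V\<close> into the defining composite
  of \<open>A\<close>, the two choices differ by \<open>IIU # VI\<close> and \<open>VII # IU\<close> in the middle, and both of these
  are the tensor product of \<open>V\<close> and \<open>U\<close>.
\<close>

section \<open>Isomorphisms and equivalences in ordinary categories\<close>

lemma inverse_mor_unique:
  assumes "category K" "inverse_mor K m n" "inverse_mor K m n'"
  shows "n = n'"
proof -
  interpret category K by fact
  have "n = Comp K n (Comp K m n')"
    using assms(2,3) Comp_Ident_right[of n] by (simp add: inverse_mor_def)
  also have "\<dots> = Comp K (Comp K n m) n'"
    using assms(2,3) Comp_assoc[of n m n'] by (simp add: inverse_mor_def)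
  also have "\<dots> = n'"
    using assms(2,3) Comp_Ident_left[of n'] by (simp add: inverse_mor_def)
  finally show ?thesis .
qed

lemma iso_mor_left_cancel:
  assumes "category K" "iso_mor K t" "m \<in> Mor K" "n \<in> Mor K"
    "Dom K m = Cod K t" "Dom K n = Cod K t" "Comp K t m = Comp K t n"
  shows "m = n"
proof -
  interpret category K by fact
  obtain s where s: "inverse_mor K t s"
    using assms(2) by (auto simp: iso_mor_def)
  have "m = Comp K s (Comp K t m)" if "m \<in> Mor K" "Dom K m = Cod K t" for m
    using s that Comp_assoc[of s t m] Comp_Ident_left[of m] by (simp add: inverse_mor_def)
  then show ?thesis
    using assms by metis
qed

text \<open>Fullness follows from the naturality of \<open>\<eta>\<close> and
  \<open>\<epsilon>\<close> alone, without triangle identities. The preimage of \<open>k\<close> is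
  the conjugate of \<open>Gm k\<close> by \<open>\<eta>\<close>; its image and \<open>k\<close> have
  the same image under \<open>Gm\<close>, and \<open>\<epsilon>\<close> shows that \<open>Gm\<close>
  separates them.\<close>

lemma equivalence_full:
  assumes K: "category K" and K': "category K'" and "equivalence K K' Fo Fm"
    and X: "X \<in> Ob K" and Y: "Y \<in> Ob K"
    and k: "k \<in> Mor K'" "Dom K' k = Fo X" "Cod K' k = Fo Y"
  obtains u where "u \<in> Mor K" "Dom K u = X" "Cod K u = Y" "Fm u = k"
proof -
  interpret K: category K by fact
  interpret K': category K' by fact
  obtain Go Gm \<eta> \<epsilon> where F: "is_functor K K' Fo Fm" and G: "is_functor K' K Go Gm"
    and \<eta>: "natural_iso K K id id (Go \<circ> Fo) (Gm \<circ> Fm) \<eta>"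
    and \<epsilon>: "natural_iso K' K' (Fo \<circ> Go) (Fm \<circ> Gm) id id \<epsilon>"
    using assms(3) by (auto simp: equivalence_def)
  interpret F: is_functor K K' Fo Fm by fact
  interpret G: is_functor K' K Go Gm by fact
  have iso\<eta>: "iso_mor K (\<eta> Z)" "Dom K (\<eta> Z) = Z" "Cod K (\<eta> Z) = Go (Fo Z)" if "Z \<in> Ob K" for Z
    using \<eta> that by (auto simp: natural_iso_def)
  have nat\<eta>: "Comp K m (\<eta> (Cod K m)) = Comp K (\<eta> (Dom K m)) (Gm (Fm m))" if "m \<in> Mor K" for m
    using \<eta> that by (simp add: natural_iso_def)
  obtain v where v: "inverse_mor K (\<eta> Y) v"
    using iso\<eta>(1)[OF Y] by (auto simp: iso_mor_def)
  have \<eta>X: "\<eta> X \<in> Mor K"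
    using iso\<eta>(1)[OF X] by (auto simp: iso_mor_def inverse_mor_def)
  note typing = iso\<eta>[OF X] iso\<eta>[OF Y] \<eta>X v[unfolded inverse_mor_def] k
    K.Comp_in K.Dom_Comp K.Cod_Comp G.Fm_in G.Dom_Fm G.Cod_Fm
  \<comment> \<open>This is the only possible choice: if \<open>Fm u = k\<close>, naturality of
    \<open>\<eta>\<close> at \<open>u\<close> reads \<open>u\<close> followed by
    \<open>\<eta> Y\<close> equals \<open>\<eta> X\<close> followed by \<open>Gm k\<close>, and
    \<open>v\<close> inverts \<open>\<eta> Y\<close>.\<close>
  define u where "u = Comp K (Comp K (\<eta> X) (Gm k)) v"
  have u: "u \<in> Mor K" "Dom K u = X" "Cod K u = Y"
    by (simp_all add: u_def typing)
  have Fu: "Fm u \<in> Mor K'" "Dom K' (Fm u) = Fo X" "Cod K' (Fm u) = Fo Y"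
    using u by (simp_all add: F.Fm_in F.Dom_Fm F.Cod_Fm)
  have "Comp K (\<eta> X) (Gm (Fm u)) = Comp K u (\<eta> Y)"
    using nat\<eta>[OF u(1)] u by simp
  also have "\<dots> = Comp K (Comp K (\<eta> X) (Gm k)) (Comp K v (\<eta> Y))"
    unfolding u_def by (subst K.Comp_assoc) (simp_all add: typing)
  also have "\<dots> = Comp K (\<eta> X) (Gm k)"
    using K.Comp_Ident_right[of "Comp K (\<eta> X) (Gm k)"] by (simp add: typing)
  finally have GFu: "Gm (Fm u) = Gm k"
    by (rule iso_mor_left_cancel[OF K iso\<eta>(1)[OF X], rotated 4]) (simp_all add: typing Fu)
  have nat\<epsilon>: "Comp K' (Fm (Gm m)) (\<epsilon> (Cod K' m)) = Comp K' (\<epsilon> (Dom K' m)) m" if "m \<in> Mor K'" for m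
    using \<epsilon> that by (simp add: natural_iso_def)
  \<comment> \<open>Faithfulness of \<open>Gm\<close> on this pair: naturality of
    \<open>\<epsilon>\<close> expresses both sides through the common image under \<open>Fm\<close>
    of \<open>Gm (Fm u) = Gm k\<close>, after which the isomorphism \<open>\<epsilon> (Fo X)\<close>
    cancels.\<close>
  have "Comp K' (\<epsilon> (Fo X)) (Fm u) = Comp K' (\<epsilon> (Fo X)) k"
    using nat\<epsilon>[OF Fu(1)] nat\<epsilon>[OF k(1)] GFu Fu k by simp
  then have "Fm u = k"
    by (rule iso_mor_left_cancel[OF K', of "\<epsilon> (Fo X)", rotated -1])
      (use \<epsilon> X Fu k in \<open>simp_all add: natural_iso_def F.Fo_in\<close>)
  with u show thesis
    by (rule that)
qed

section \<open>Typing rules and equational calculus of arrows and 2-cells in a strict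
  2-category\<close>

context strict_2_category
begin

lemma arrow_simps [simp]:
  "f \<in> Arr C \<Longrightarrow> src C f \<in> Obj C"
  "f \<in> Arr C \<Longrightarrow> tgt C f \<in> Obj C"
  "X \<in> Obj C \<Longrightarrow> \<one> X \<in> Arr C"
  "X \<in> Obj C \<Longrightarrow> src C (\<one> X) = X"
  "X \<in> Obj C \<Longrightarrow> tgt C (\<one> X) = X"
  "\<lbrakk>f \<in> Arr C; g \<in> Arr C; tgt C f = src C g\<rbrakk> \<Longrightarrow> f \<odot> g \<in> Arr C"
  "\<lbrakk>f \<in> Arr C; g \<in> Arr C; tgt C f = src C g\<rbrakk> \<Longrightarrow> src C (f \<odot> g) = src C f"
  "\<lbrakk>f \<in> Arr C; g \<in> Arr C; tgt C f = src C g\<rbrakk> \<Longrightarrow> tgt C (f \<odot> g) = tgt C g"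
  "\<lbrakk>f \<in> Arr C; src C f = X\<rbrakk> \<Longrightarrow> \<one> X \<odot> f = f"
  "\<lbrakk>f \<in> Arr C; tgt C f = X\<rbrakk> \<Longrightarrow> f \<odot> \<one> X = f"
  using arrow_category by (auto simp: category_def arrow_cat_def)

lemma acomp_assoc:
  "\<lbrakk>f \<in> Arr C; g \<in> Arr C; h \<in> Arr C; tgt C f = src C g; tgt C g = src C h\<rbrakk>
    \<Longrightarrow> f \<odot> g \<odot> h = f \<odot> (g \<odot> h)"
  using arrow_category by (auto simp: category_def arrow_cat_def)

lemma vertical_simps [simp]:
  "a \<in> Cell C \<Longrightarrow> csrc C a \<in> Arr C"
  "a \<in> Cell C \<Longrightarrow> ctgt C a \<in> Arr C"
  "f \<in> Arr C \<Longrightarrow> \<iota> f \<in> Cell C"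
  "f \<in> Arr C \<Longrightarrow> csrc C (\<iota> f) = f"
  "f \<in> Arr C \<Longrightarrow> ctgt C (\<iota> f) = f"
  "\<lbrakk>a \<in> Cell C; b \<in> Cell C; ctgt C a = csrc C b\<rbrakk> \<Longrightarrow> a \<bullet> b \<in> Cell C"
  "\<lbrakk>a \<in> Cell C; b \<in> Cell C; ctgt C a = csrc C b\<rbrakk> \<Longrightarrow> csrc C (a \<bullet> b) = csrc C a"
  "\<lbrakk>a \<in> Cell C; b \<in> Cell C; ctgt C a = csrc C b\<rbrakk> \<Longrightarrow> ctgt C (a \<bullet> b) = ctgt C b"
  "\<lbrakk>a \<in> Cell C; csrc C a = f\<rbrakk> \<Longrightarrow> \<iota> f \<bullet> a = a"
  "\<lbrakk>a \<in> Cell C; ctgt C a = f\<rbrakk> \<Longrightarrow> a \<bullet> \<iota> f = a"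
  using vertical_category by (auto simp: category_def vertical_cat_def)

lemma vcomp_assoc:
  "\<lbrakk>a \<in> Cell C; b \<in> Cell C; c \<in> Cell C; ctgt C a = csrc C b; ctgt C b = csrc C c\<rbrakk>
    \<Longrightarrow> a \<bullet> b \<bullet> c = a \<bullet> (b \<bullet> c)"
  using vertical_category by (auto simp: category_def vertical_cat_def)

lemma horizontal_simps [simp]:
  "\<lbrakk>a \<in> Cell C; b \<in> Cell C; tgt C (csrc C a) = src C (csrc C b)\<rbrakk> \<Longrightarrow> a \<star> b \<in> Cell C"
  "\<lbrakk>a \<in> Cell C; src C (csrc C a) = X\<rbrakk> \<Longrightarrow> \<iota> (\<one> X) \<star> a = a"
  "\<lbrakk>a \<in> Cell C; tgt C (csrc C a) = X\<rbrakk> \<Longrightarrow> a \<star> \<iota> (\<one> X) = a"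
  using horizontal_category by (auto simp: category_def horizontal_cat_def)

lemma hcomp_assoc:
  "\<lbrakk>a \<in> Cell C; b \<in> Cell C; c \<in> Cell C; tgt C (csrc C a) = src C (csrc C b);
      tgt C (csrc C b) = src C (csrc C c)\<rbrakk> \<Longrightarrow> a \<star> b \<star> c = a \<star> (b \<star> c)"
  using horizontal_category by (auto simp: category_def horizontal_cat_def)

declare src_ctgt [simp] tgt_ctgt [simp] csrc_hcomp [simp] ctgt_hcomp [simp]

lemma cellsD:
  assumes "a \<in> cells C f g"
  shows "a \<in> Cell C" "csrc C a = f" "ctgt C a = g" "f \<in> Arr C" "g \<in> Arr C"
  using assms by (auto simp: cells_def)

lemma cells_parallel:
  assumes "a \<in> cells C f g"
  shows "src C g = src C f" "tgt C g = tgt C f"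
  using assms by (auto simp: cells_def)

lemma cells_vcomp: "\<lbrakk>a \<in> cells C f g; b \<in> cells C g h\<rbrakk> \<Longrightarrow> a \<bullet> b \<in> cells C f h"
  by (simp add: cells_def)

lemma cells_hcomp:
  "\<lbrakk>a \<in> cells C f g; b \<in> cells C f' g'; tgt C f = src C f'\<rbrakk> \<Longrightarrow> a \<star> b \<in> cells C (f \<odot> f') (g \<odot> g')"
  by (auto simp: cells_def)

lemma cells_ident: "f \<in> Arr C \<Longrightarrow> \<iota> f \<in> cells C f f"
  by (simp add: cells_def)

text \<open>Inverses in the vertical category are unique, so the definite description behind
  \<open>inv_cell\<close> denotes the actual inverse.\<close>

lemma inv_cell:
  assumes "invertible_cell C a" "a \<in> cells C f g"
  shows "inv_cell C a \<in> cells C g f" "a \<bullet> inv_cell C a = \<iota> f" "inv_cell C a \<bullet> a = \<iota> g"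
proof -
  obtain b where "inverse_mor (vertical_cat C) a b"
    using assms(1) by (auto simp: invertible_cell_def iso_mor_def)
  then have "inverse_mor (vertical_cat C) a (inv_cell C a)"
    unfolding inv_cell_def
    by (rule theI) (rule inverse_mor_unique[OF vertical_category _ \<open>inverse_mor _ _ b\<close>])
  then show "inv_cell C a \<in> cells C g f" "a \<bullet> inv_cell C a = \<iota> f" "inv_cell C a \<bullet> a = \<iota> g"
    using assms(2) by (auto simp: inverse_mor_def vertical_cat_def cells_def)
qed

lemma invertible_cellI:
  assumes "a \<in> cells C f g" "b \<in> cells C g f" "a \<bullet> b = \<iota> f" "b \<bullet> a = \<iota> g"
  shows "invertible_cell C a"
  using assms
  by (auto simp: invertible_cell_def iso_mor_def inverse_mor_def vertical_cat_def cells_def)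

section \<open>Whiskering with equi-arrows\<close>

lemma hcomp_nat:
  assumes "a \<in> cells C f f'" "b \<in> cells C g g'" "tgt C f = src C g"
  shows "(a \<star> \<iota> g) \<bullet> (\<iota> f' \<star> b) = a \<star> b"
  using assms cellsD[OF assms(1)] cellsD[OF assms(2)] interchange[of a "\<iota> f'" "\<iota> g" b] by auto

text \<open>Both \<open>\<iota> e \<star> c\<close> and \<open>c\<close> are linked to
  \<open>a \<star> c\<close> by interchange, since whiskering with the identity arrow at the target
  of \<open>a\<close> does nothing. Hence whiskering with \<open>e\<close> is conjugation by
  whiskerings of \<open>a\<close>.\<close>

lemma whisker_by_iso_to_ident:
  assumes e: "e \<in> Arr C" "tgt C e = src C e" and a: "a \<in> cells C e (\<one> (src C e))" "invertible_cell C a"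
    and g: "g \<in> Arr C" "src C g = src C e" and h: "h \<in> Arr C" "src C h = src C e"
    and c: "c \<in> cells C g h"
  shows "\<iota> e \<star> c = (a \<star> \<iota> g) \<bullet> c \<bullet> (inv_cell C a \<star> \<iota> h)"
proof -
  note b = inv_cell[OF a(2,1)]
  note D = cellsD[OF a(1)] cellsD[OF c] cellsD[OF b(1)] e g h
  have "(a \<star> \<iota> g) \<bullet> c = a \<star> c"
    using hcomp_nat[OF a(1) c] D by simp
  then show ?thesis
    using b interchange[of a "inv_cell C a" c "\<iota> h"] D by simp
qed

text \<open>A 2-cell \<open>d\<close> can be recovered from \<open>\<iota> f \<star> d\<close>:
  whisker with a pseudo-inverse \<open>f'\<close> and conjugate by the isomorphism \<open>b\<close>
  from \<open>f' \<odot> f\<close> to the identity. The equation \<open>key\<close> is this recovery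
  formula.\<close>

lemma equi_whisker_inj:
  assumes f: "equi_arrow C f" and c: "c \<in> cells C g h" "c' \<in> cells C g h" and g: "src C g = tgt C f"
    and eq: "\<iota> f \<star> c = \<iota> f \<star> c'"
  shows "c = c'"
proof -
  obtain f' b where f': "f \<in> Arr C" "f' \<in> Arr C" "src C f' = tgt C f" "tgt C f' = src C f"
    and b: "b \<in> cells C (f' \<odot> f) (\<one> (tgt C f))" "invertible_cell C b"
    using f by (auto simp: equi_arrow_def hom_def)
  note i = inv_cell[OF b(2,1)]
  have key: "d = (inv_cell C b \<star> \<iota> g) \<bullet> (\<iota> f' \<star> (\<iota> f \<star> d)) \<bullet> (b \<star> \<iota> h)"
    if "d \<in> cells C g h" for d
  proof -
    note D = cellsD[OF b(1)] cellsD[OF i(1)] cellsD[OF that] cells_parallel[OF that] f' g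
    have "\<iota> f' \<star> (\<iota> f \<star> d) = \<iota> (f' \<odot> f) \<star> d"
      using D by (simp add: id_cell_acomp hcomp_assoc)
    also have "(inv_cell C b \<star> \<iota> g) \<bullet> \<dots> = inv_cell C b \<star> d"
      using hcomp_nat[OF i(1) that] D by simp
    also have "\<dots> \<bullet> (b \<star> \<iota> h) = d"
      using interchange[of "inv_cell C b" b d "\<iota> h"] D i by simp
    finally show ?thesis ..
  qed
  show ?thesis
    using key[OF c(1)] key[OF c(2)] eq by simp
qed

text \<open>The recovery formula for whiskering with \<open>f\<close> supplies the candidate. That
  it is a preimage of \<open>c\<close> is checked after a further whiskering with the
  pseudo-inverse, which is injective as well; no compatibility between the two isomorphisms
  \<open>a\<close> and \<open>b\<close> enters.\<close>

lemma equi_whisker_ex1: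
  assumes f: "equi_arrow C f" and g: "g \<in> Arr C" "src C g = tgt C f" and h: "h \<in> Arr C" "src C h = tgt C f"
    and tgh: "tgt C g = tgt C h" and c: "c \<in> cells C (f \<odot> g) (f \<odot> h)"
  shows "\<exists>!d. d \<in> cells C g h \<and> c = \<iota> f \<star> d"
proof -
  obtain f' a b where f': "f \<in> Arr C" "f' \<in> Arr C" "src C f' = tgt C f" "tgt C f' = src C f"
    and a: "a \<in> cells C (f \<odot> f') (\<one> (src C f))" "invertible_cell C a"
    and b: "b \<in> cells C (f' \<odot> f) (\<one> (tgt C f))" "invertible_cell C b"
    using f by (auto simp: equi_arrow_def hom_def)
  \<comment> \<open>Being a pseudo-inverse is symmetric: \<open>f\<close> serves for
    \<open>f'\<close>, with \<open>a\<close> and \<open>b\<close> exchanged.\<close>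
  have equi': "equi_arrow C f'"
    using f' a b by (auto simp: equi_arrow_def hom_def intro!: bexI[of _ f])
  note i = inv_cell[OF b(2,1)]
  note D = cellsD[OF b(1)] cellsD[OF i(1)] cellsD[OF c] f' g h tgh
  define m where "m = \<iota> f' \<star> c"
  have m: "m \<in> cells C (f' \<odot> f \<odot> g) (f' \<odot> f \<odot> h)"
    using cells_hcomp[OF cells_ident[of f'] c] D by (simp add: m_def acomp_assoc)
  define d where "d = (inv_cell C b \<star> \<iota> g) \<bullet> m \<bullet> (b \<star> \<iota> h)"
  note D = D cellsD[OF m]
  have d: "d \<in> cells C g h"
    using D by (simp add: d_def cells_def)
  have fd: "\<iota> f \<star> d \<in> cells C (f \<odot> g) (f \<odot> h)"
    using cells_hcomp[OF cells_ident[of f] d] D by simp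
  have 1: "(b \<star> \<iota> g) \<bullet> (inv_cell C b \<star> \<iota> g) = \<iota> (f' \<odot> f \<odot> g)"
    using interchange[of b "inv_cell C b" "\<iota> g" "\<iota> g"] D i id_cell_acomp[of "f' \<odot> f" g] by simp
  have 2: "(b \<star> \<iota> h) \<bullet> (inv_cell C b \<star> \<iota> h) = \<iota> (f' \<odot> f \<odot> h)"
    using interchange[of b "inv_cell C b" "\<iota> h" "\<iota> h"] D i id_cell_acomp[of "f' \<odot> f" h] by simp
  have "\<iota> f' \<star> (\<iota> f \<star> d) = \<iota> (f' \<odot> f) \<star> d"
    using D cellsD[OF d] by (simp add: id_cell_acomp hcomp_assoc)
  \<comment> \<open>Whiskering with \<open>f' \<odot> f\<close> conjugates by \<open>b\<close>,
    which is exactly what undoes the conjugation in the definition of \<open>d\<close>.\<close>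
  also have "\<dots> = (b \<star> \<iota> g) \<bullet> d \<bullet> (inv_cell C b \<star> \<iota> h)"
    by (rule whisker_by_iso_to_ident) (use D b d in auto)
  also have "\<dots> = ((b \<star> \<iota> g) \<bullet> (inv_cell C b \<star> \<iota> g)) \<bullet> m \<bullet> ((b \<star> \<iota> h) \<bullet> (inv_cell C b \<star> \<iota> h))"
    unfolding d_def using D by (simp add: vcomp_assoc)
  also have "\<dots> = m"
    unfolding 1 2 using D by simp
  \<comment> \<open>The two cells agree after whiskering with \<open>f'\<close>, hence are
    equal.\<close>
  finally have "\<iota> f \<star> d = c"
    unfolding m_def using equi_whisker_inj[OF equi' fd c] D by simp
  then show ?thesis
    using d equi_whisker_inj[OF f] g by blast
qed

lemma equi_arrow_ident:
  assumes "X \<in> Obj C"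
  shows "equi_arrow C (\<one> X)"
proof -
  have "\<iota> (\<one> X) \<in> cells C (\<one> X) (\<one> X)" "invertible_cell C (\<iota> (\<one> X))"
    using assms by (auto intro!: cells_ident invertible_cellI)
  then show ?thesis
    unfolding equi_arrow_def using assms by (intro conjI bexI[of _ "\<one> X"]) (auto simp: hom_def)
qed

section \<open>Hom categories and fullness of 2-functors on 2-cells\<close>

lemma hom_cat_category: "category (hom_cat C X Y)"
  by unfold_locales (auto simp: hom_cat_def vertical_cat_def hom_def vcomp_assoc)

text \<open>An equivalence of hom categories is full. For a cancellable \<open>I\<close> this allows
  \<open>I\<close> to be stripped off a 2-cell between arrows tensored with
  \<open>I\<close>.\<close>

lemma fully_faithful_2_functor_full:
  assumes "strict_2_category D" "fully_faithful_2_functor C D Fo Fa Fc"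
    and f: "f \<in> hom C X Y" and g: "g \<in> hom C X Y" and XY: "X \<in> Obj C" "Y \<in> Obj C"
    and k: "k \<in> cells D (Fa f) (Fa g)"
  obtains u where "u \<in> cells C f g" "Fc u = k"
proof -
  interpret D: strict_2_category D by fact
  have equiv: "equivalence (hom_cat C X Y) (hom_cat D (Fo X) (Fo Y)) Fa Fc"
    using assms(2) XY by (auto simp: fully_faithful_2_functor_def)
  then have F: "is_functor (hom_cat C X Y) (hom_cat D (Fo X) (Fo Y)) Fa Fc"
    by (simp add: equivalence_def)
  \<comment> \<open>This typing places \<open>k\<close> in the hom category to which fullness
    applies.\<close>
  have "Fa f \<in> hom D (Fo X) (Fo Y)" "Fa g \<in> hom D (Fo X) (Fo Y)"
    using is_functor.Fo_in[OF F] f g by (auto simp: hom_cat_def)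
  then show ?thesis
    using equivalence_full[OF hom_cat_category D.hom_cat_category equiv, of f g k] f g k that
    by (auto simp: hom_cat_def vertical_cat_def cells_def)
qed

end

section \<open>Calculus of the tensor product as a strict 2-functor\<close>

context semi_monoidal_2_category
begin

lemma tensor_functors:
  "is_functor (arrow_cat (prod_2_cat C C)) (arrow_cat C) (\<lambda>(X, Y). X \<otimes>\<^sub>o Y) (\<lambda>(f, g). f \<otimes>\<^sub>a g)"
  "is_functor (vertical_cat (prod_2_cat C C)) (vertical_cat C) (\<lambda>(f, g). f \<otimes>\<^sub>a g) (\<lambda>(a, b). a \<otimes>\<^sub>c b)"
  "is_functor (horizontal_cat (prod_2_cat C C)) (horizontal_cat C) (\<lambda>(X, Y). X \<otimes>\<^sub>o Y) (\<lambda>(a, b). a \<otimes>\<^sub>c b)"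
  using tensor_2_functor by (simp_all add: strict_2_functor_def)

lemma tensor_arr_simps [simp]:
  "\<lbrakk>X \<in> Obj C; Y \<in> Obj C\<rbrakk> \<Longrightarrow> X \<otimes>\<^sub>o Y \<in> Obj C"
  "\<lbrakk>f \<in> Arr C; g \<in> Arr C\<rbrakk> \<Longrightarrow> f \<otimes>\<^sub>a g \<in> Arr C"
  "\<lbrakk>f \<in> Arr C; g \<in> Arr C\<rbrakk> \<Longrightarrow> src C (f \<otimes>\<^sub>a g) = src C f \<otimes>\<^sub>o src C g"
  "\<lbrakk>f \<in> Arr C; g \<in> Arr C\<rbrakk> \<Longrightarrow> tgt C (f \<otimes>\<^sub>a g) = tgt C f \<otimes>\<^sub>o tgt C g"
  using tensor_functors(1) by (auto simp: is_functor_def arrow_cat_def prod_2_cat_def)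

lemma tensor_ident: "\<lbrakk>X \<in> Obj C; Y \<in> Obj C\<rbrakk> \<Longrightarrow> \<one> X \<otimes>\<^sub>a \<one> Y = \<one> (X \<otimes>\<^sub>o Y)"
  using tensor_functors(1) by (auto simp: is_functor_def arrow_cat_def prod_2_cat_def)

lemma tensor_acomp:
  "\<lbrakk>f \<in> Arr C; g \<in> Arr C; f' \<in> Arr C; g' \<in> Arr C; tgt C f = src C f'; tgt C g = src C g'\<rbrakk>
    \<Longrightarrow> (f \<odot> f') \<otimes>\<^sub>a (g \<odot> g') = (f \<otimes>\<^sub>a g) \<odot> (f' \<otimes>\<^sub>a g')"
  using is_functor.Fm_Comp[OF tensor_functors(1), of "(f, g)" "(f', g')"]
  by (simp add: arrow_cat_def prod_2_cat_def)

lemma tensor_cell_simps [simp]: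
  "\<lbrakk>a \<in> Cell C; b \<in> Cell C\<rbrakk> \<Longrightarrow> a \<otimes>\<^sub>c b \<in> Cell C"
  "\<lbrakk>a \<in> Cell C; b \<in> Cell C\<rbrakk> \<Longrightarrow> csrc C (a \<otimes>\<^sub>c b) = csrc C a \<otimes>\<^sub>a csrc C b"
  "\<lbrakk>a \<in> Cell C; b \<in> Cell C\<rbrakk> \<Longrightarrow> ctgt C (a \<otimes>\<^sub>c b) = ctgt C a \<otimes>\<^sub>a ctgt C b"
  using tensor_functors(2) by (auto simp: is_functor_def vertical_cat_def prod_2_cat_def)

lemma tensor_id_cell: "\<lbrakk>f \<in> Arr C; g \<in> Arr C\<rbrakk> \<Longrightarrow> \<iota> f \<otimes>\<^sub>c \<iota> g = \<iota> (f \<otimes>\<^sub>a g)"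
  using tensor_functors(2) by (auto simp: is_functor_def vertical_cat_def prod_2_cat_def)

lemma tensor_vcomp:
  "\<lbrakk>a \<in> Cell C; b \<in> Cell C; a' \<in> Cell C; b' \<in> Cell C; ctgt C a = csrc C a'; ctgt C b = csrc C b'\<rbrakk>
    \<Longrightarrow> (a \<bullet> a') \<otimes>\<^sub>c (b \<bullet> b') = (a \<otimes>\<^sub>c b) \<bullet> (a' \<otimes>\<^sub>c b')"
  using is_functor.Fm_Comp[OF tensor_functors(2), of "(a, b)" "(a', b')"]
  by (simp add: vertical_cat_def prod_2_cat_def)

lemma tensor_hcomp:
  "\<lbrakk>a \<in> Cell C; b \<in> Cell C; a' \<in> Cell C; b' \<in> Cell C; tgt C (csrc C a) = src C (csrc C a');
      tgt C (csrc C b) = src C (csrc C b')\<rbrakk>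
    \<Longrightarrow> (a \<star> a') \<otimes>\<^sub>c (b \<star> b') = (a \<otimes>\<^sub>c b) \<star> (a' \<otimes>\<^sub>c b')"
  using is_functor.Fm_Comp[OF tensor_functors(3), of "(a, b)" "(a', b')"]
  by (simp add: horizontal_cat_def prod_2_cat_def)

lemma cells_tensor:
  "\<lbrakk>a \<in> cells C f g; b \<in> cells C f' g'\<rbrakk> \<Longrightarrow> a \<otimes>\<^sub>c b \<in> cells C (f \<otimes>\<^sub>a f') (g \<otimes>\<^sub>a g')"
  by (auto simp: cells_def)

lemma invertible_tensor:
  assumes a: "a \<in> cells C f g" "invertible_cell C a" and b: "b \<in> cells C f' g'" "invertible_cell C b"
  shows "invertible_cell C (a \<otimes>\<^sub>c b)"
proof -
  note i = inv_cell[OF a(2,1)] and j = inv_cell[OF b(2,1)]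
  note D = cellsD[OF a(1)] cellsD[OF b(1)] cellsD[OF i(1)] cellsD[OF j(1)]
  show ?thesis
    by (rule invertible_cellI[OF cells_tensor[OF a(1) b(1)] cells_tensor[OF i(1) j(1)]])
      (use D i j in \<open>simp_all add: tensor_vcomp[symmetric] tensor_id_cell\<close>)
qed

text \<open>Strict functoriality lets pseudo-inverses and their invertible 2-cells be tensored
  componentwise. This is what makes \<open>I\<alpha>I\<close> an equi-arrow.\<close>

lemma equi_arrow_tensor:
  assumes "equi_arrow C f" "equi_arrow C g"
  shows "equi_arrow C (f \<otimes>\<^sub>a g)"
proof -
  obtain f' a b where f': "f \<in> Arr C" "f' \<in> Arr C" "src C f' = tgt C f" "tgt C f' = src C f"
    and a: "a \<in> cells C (f \<odot> f') (\<one> (src C f))" "invertible_cell C a"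
    and b: "b \<in> cells C (f' \<odot> f) (\<one> (tgt C f))" "invertible_cell C b"
    using assms(1) by (auto simp: equi_arrow_def hom_def)
  obtain g' c d where g': "g \<in> Arr C" "g' \<in> Arr C" "src C g' = tgt C g" "tgt C g' = src C g"
    and c: "c \<in> cells C (g \<odot> g') (\<one> (src C g))" "invertible_cell C c"
    and d: "d \<in> cells C (g' \<odot> g) (\<one> (tgt C g))" "invertible_cell C d"
    using assms(2) by (auto simp: equi_arrow_def hom_def)
  have "f' \<otimes>\<^sub>a g' \<in> hom C (tgt C (f \<otimes>\<^sub>a g)) (src C (f \<otimes>\<^sub>a g))"
    using f' g' by (simp add: hom_def)
  moreover have "a \<otimes>\<^sub>c c \<in> cells C ((f \<otimes>\<^sub>a g) \<odot> (f' \<otimes>\<^sub>a g')) (\<one> (src C (f \<otimes>\<^sub>a g)))"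
    using cells_tensor[OF a(1) c(1)] f' g' by (simp add: tensor_acomp tensor_ident)
  moreover have "b \<otimes>\<^sub>c d \<in> cells C ((f' \<otimes>\<^sub>a g') \<odot> (f \<otimes>\<^sub>a g)) (\<one> (tgt C (f \<otimes>\<^sub>a g)))"
    using cells_tensor[OF b(1) d(1)] f' g' by (simp add: tensor_acomp tensor_ident)
  moreover have "invertible_cell C (a \<otimes>\<^sub>c c)" "invertible_cell C (b \<otimes>\<^sub>c d)"
    using invertible_tensor a b c d by blast+
  ultimately show ?thesis
    using f' g' unfolding equi_arrow_def by auto
qed

text \<open>Both sides equal \<open>f \<otimes>\<^sub>a g\<close> by functoriality. The case of
  \<open>\<rho>\<close> and \<open>\<lambda>\<close> at \<open>I\<close> gives the equality of
  arrows in the middle of the composite defining \<open>A\<close>.\<close>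

lemma acomp_tensor_exchange:
  "\<lbrakk>f \<in> Arr C; g \<in> Arr C\<rbrakk> \<Longrightarrow>
    (\<one> (src C f) \<otimes>\<^sub>a g) \<odot> (f \<otimes>\<^sub>a \<one> (tgt C g)) = (f \<otimes>\<^sub>a \<one> (src C g)) \<odot> (\<one> (tgt C f) \<otimes>\<^sub>a g)"
  by (simp add: tensor_acomp[symmetric])

text \<open>Both sides equal \<open>a \<otimes>\<^sub>c b\<close>, because the tensor product
  preserves horizontal composition.\<close>

lemma whisker_tensor_exchange:
  assumes a: "a \<in> cells C f f'" and b: "b \<in> cells C g g'"
  shows "(\<iota> (\<one> (src C f)) \<otimes>\<^sub>c b) \<star> (a \<otimes>\<^sub>c \<iota> (\<one> (tgt C g)))
    = (a \<otimes>\<^sub>c \<iota> (\<one> (src C g))) \<star> (\<iota> (\<one> (tgt C f)) \<otimes>\<^sub>c b)"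
  using cellsD[OF a] cellsD[OF b] by (simp add: tensor_hcomp[symmetric])

end

text \<open>The left-hand side of the equation defining \<open>A\<close>, as a function of the
  components \<open>l\<close> and \<open>r\<close> of the constraints at \<open>I\<close>, the only
  ones that occur in it.\<close>

definition associator_composite ::
  "('o, 'a, 'c, 'e) semi_monoidal_scheme \<Rightarrow> 'o \<Rightarrow> 'c \<Rightarrow> 'c \<Rightarrow> 'c" where
  "associator_composite C I l r =
     ((\<iota>\<^bsub>C\<^esub> (\<one>\<^bsub>C\<^esub> I) \<otimes>\<^sub>c\<^bsub>C\<^esub> inv_cell C l) \<star>\<^bsub>C\<^esub> r)
       \<bullet>\<^bsub>C\<^esub> ((inv_cell C r \<otimes>\<^sub>c\<^bsub>C\<^esub> \<iota>\<^bsub>C\<^esub> (\<one>\<^bsub>C\<^esub> I)) \<star>\<^bsub>C\<^esub> l)"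

section \<open>The composite defining \<open>A\<close> and its independence of the
  constraints\<close>

context semi_monoidal_2_category
begin

lemma associator_composite_cells:
  assumes I: "I \<in> Obj C" and \<alpha>: "\<alpha> \<in> hom C (I \<otimes>\<^sub>o I) I"
    and p: "p \<in> hom C (I \<otimes>\<^sub>o I) I" and q: "q \<in> hom C (I \<otimes>\<^sub>o I) I"
    and l: "l \<in> cells C (\<one> I \<otimes>\<^sub>a p) (\<alpha> \<otimes>\<^sub>a \<one> I)" "invertible_cell C l"
    and r: "r \<in> cells C (\<one> I \<otimes>\<^sub>a \<alpha>) (q \<otimes>\<^sub>a \<one> I)" "invertible_cell C r"
  shows "associator_composite C I l r \<in> cells C
    ((\<one> I \<otimes>\<^sub>a \<alpha> \<otimes>\<^sub>a \<one> I) \<odot> (\<one> I \<otimes>\<^sub>a \<alpha>)) ((\<one> I \<otimes>\<^sub>a \<alpha> \<otimes>\<^sub>a \<one> I) \<odot> (\<alpha> \<otimes>\<^sub>a \<one> I))"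
proof -
  note h = I \<alpha>[unfolded hom_def, simplified] p[unfolded hom_def, simplified] q[unfolded hom_def, simplified]
  note i = inv_cell[OF l(2,1)] and j = inv_cell[OF r(2,1)]
  \<comment> \<open>The two factors are composable only thanks to this strict equality. It is the
    exchange law for \<open>q\<close> and \<open>p\<close>, with the identity on \<open>II\<close>
    split as a tensor product of identities on \<open>I\<close>.\<close>
  have eq: "(\<one> I \<otimes>\<^sub>a (\<one> I \<otimes>\<^sub>a p)) \<odot> (q \<otimes>\<^sub>a \<one> I) = ((q \<otimes>\<^sub>a \<one> I) \<otimes>\<^sub>a \<one> I) \<odot> (\<one> I \<otimes>\<^sub>a p)"
    using acomp_tensor_exchange[of q p] h
    by (simp add: tensor_arr_assoc flip: tensor_ident)
  have 1: "(\<iota> (\<one> I) \<otimes>\<^sub>c inv_cell C l) \<star> r \<in> cells C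
      ((\<one> I \<otimes>\<^sub>a \<alpha> \<otimes>\<^sub>a \<one> I) \<odot> (\<one> I \<otimes>\<^sub>a \<alpha>)) ((\<one> I \<otimes>\<^sub>a (\<one> I \<otimes>\<^sub>a p)) \<odot> (q \<otimes>\<^sub>a \<one> I))"
    using cells_hcomp[OF cells_tensor[OF cells_ident[of "\<one> I"] i(1)] r(1)] h
    by (simp add: tensor_arr_assoc)
  have 2: "(inv_cell C r \<otimes>\<^sub>c \<iota> (\<one> I)) \<star> l \<in> cells C
      (((q \<otimes>\<^sub>a \<one> I) \<otimes>\<^sub>a \<one> I) \<odot> (\<one> I \<otimes>\<^sub>a p)) ((\<one> I \<otimes>\<^sub>a \<alpha> \<otimes>\<^sub>a \<one> I) \<odot> (\<alpha> \<otimes>\<^sub>a \<one> I))"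
    using cells_hcomp[OF cells_tensor[OF j(1) cells_ident[of "\<one> I"]] l(1)] h
    by (simp add: tensor_obj_assoc)
  show ?thesis
    unfolding associator_composite_def using cells_vcomp[OF 1 2[folded eq]] .
qed

text \<open>The first factor of the primed composite ends in a 2-cell \<open>M\<close>, and the
  second factor of the unprimed one begins with the same \<open>M\<close>. Both composites are
  therefore bracketings of one threefold vertical composite.\<close>

lemma associator_composite_cong:
  assumes I: "cancellable C I" and \<alpha>: "\<alpha> \<in> hom C (I \<otimes>\<^sub>o I) I"
    and p: "p \<in> hom C (I \<otimes>\<^sub>o I) I" and q: "q \<in> hom C (I \<otimes>\<^sub>o I) I"
    and p': "p' \<in> hom C (I \<otimes>\<^sub>o I) I" and q': "q' \<in> hom C (I \<otimes>\<^sub>o I) I"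
    and l: "l \<in> cells C (\<one> I \<otimes>\<^sub>a p) (\<alpha> \<otimes>\<^sub>a \<one> I)" "invertible_cell C l"
    and r: "r \<in> cells C (\<one> I \<otimes>\<^sub>a \<alpha>) (q \<otimes>\<^sub>a \<one> I)" "invertible_cell C r"
    and l': "l' \<in> cells C (\<one> I \<otimes>\<^sub>a p') (\<alpha> \<otimes>\<^sub>a \<one> I)" "invertible_cell C l'"
    and r': "r' \<in> cells C (\<one> I \<otimes>\<^sub>a \<alpha>) (q' \<otimes>\<^sub>a \<one> I)" "invertible_cell C r'"
  shows "associator_composite C I l r = associator_composite C I l' r'"
proof -
  have I': "I \<in> Obj C"
    using I by (simp add: cancellable_def)
  note i = inv_cell[OF l(2,1)] and j = inv_cell[OF r(2,1)]
  note i' = inv_cell[OF l'(2,1)] and j' = inv_cell[OF r'(2,1)]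
  \<comment> \<open>The comparison \<open>l \<bullet> inv_cell C l'\<close> runs between arrows of
    the form \<open>I\<close> tensored with \<open>p\<close> and \<open>p'\<close>, so fullness of
    tensoring with \<open>I\<close> on the left provides \<open>U\<close>. In the same way,
    tensoring on the right provides \<open>V\<close>.\<close>
  obtain U where U: "U \<in> cells C p p'" "\<iota> (\<one> I) \<otimes>\<^sub>c U = l \<bullet> inv_cell C l'"
    using fully_faithful_2_functor_full[OF strict_2_category_axioms _ p p', of "\<lambda>X. I \<otimes>\<^sub>o X"
        "\<lambda>f. \<one> I \<otimes>\<^sub>a f" "\<lambda>a. \<iota> (\<one> I) \<otimes>\<^sub>c a"] I I' cells_vcomp[OF l(1) i'(1)]
    by (auto simp: cancellable_def)
  obtain V where V: "V \<in> cells C q q'" "V \<otimes>\<^sub>c \<iota> (\<one> I) = inv_cell C r \<bullet> r'"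
    using fully_faithful_2_functor_full[OF strict_2_category_axioms _ q q', of "\<lambda>X. X \<otimes>\<^sub>o I"
        "\<lambda>f. f \<otimes>\<^sub>a \<one> I" "\<lambda>a. a \<otimes>\<^sub>c \<iota> (\<one> I)"] I I' cells_vcomp[OF j(1) r'(1)]
    by (auto simp: cancellable_def)
  note h = I' \<alpha>[unfolded hom_def, simplified] p[unfolded hom_def, simplified]
    q[unfolded hom_def, simplified] p'[unfolded hom_def, simplified] q'[unfolded hom_def, simplified]
  note D = h cellsD[OF l(1)] cellsD[OF r(1)] cellsD[OF l'(1)] cellsD[OF r'(1)] cellsD[OF i(1)]
    cellsD[OF j(1)] cellsD[OF i'(1)] cellsD[OF j'(1)] cellsD[OF U(1)] cellsD[OF V(1)]
  define IU where "IU = \<iota> (\<one> I) \<otimes>\<^sub>c U"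
  define VI where "VI = V \<otimes>\<^sub>c \<iota> (\<one> I)"
  have IU: "IU \<in> Cell C" "csrc C IU = \<one> I \<otimes>\<^sub>a p" "ctgt C IU = \<one> I \<otimes>\<^sub>a p'"
    and VI: "VI \<in> Cell C" "csrc C VI = q \<otimes>\<^sub>a \<one> I" "ctgt C VI = q' \<otimes>\<^sub>a \<one> I"
    using D by (simp_all add: IU_def VI_def)
  \<comment> \<open>The comparison cells are now moved to where they are needed: the first factor is
    rewritten in \<open>l\<close> and \<open>r\<close>, the second in \<open>l'\<close> and
    \<open>r'\<close>.\<close>
  have l_eq: "l = IU \<bullet> l'"
    using D i' by (simp add: IU_def U(2) vcomp_assoc)
  have inv_l'_eq: "inv_cell C l' = inv_cell C l \<bullet> IU"
    using D i by (simp add: IU_def U(2) vcomp_assoc[symmetric])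
  have r'_eq: "r' = r \<bullet> VI"
    using D j by (simp add: VI_def V(2) vcomp_assoc[symmetric])
  have inv_r_eq: "inv_cell C r = VI \<bullet> inv_cell C r'"
    using D j' by (simp add: VI_def V(2) vcomp_assoc)
  define IL where "IL = \<iota> (\<one> I) \<otimes>\<^sub>c inv_cell C l"
  define RI where "RI = inv_cell C r' \<otimes>\<^sub>c \<iota> (\<one> I)"
  have IL: "IL \<in> Cell C" "csrc C IL = \<one> I \<otimes>\<^sub>a (\<alpha> \<otimes>\<^sub>a \<one> I)" "ctgt C IL = \<one> I \<otimes>\<^sub>a (\<one> I \<otimes>\<^sub>a p)"
    and RI: "RI \<in> Cell C" "csrc C RI = (q' \<otimes>\<^sub>a \<one> I) \<otimes>\<^sub>a \<one> I" "ctgt C RI = (\<one> I \<otimes>\<^sub>a \<alpha>) \<otimes>\<^sub>a \<one> I"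
    using D by (simp_all add: IL_def RI_def)
  define M where "M = (\<iota> (\<one> I) \<otimes>\<^sub>c IU) \<star> VI"
  \<comment> \<open>Strict associativity gathers the two copies of \<open>I\<close> into
    \<open>II\<close>, the form in which the exchange law rewrites \<open>M\<close> in its second
    shape; both shapes are the tensor product of \<open>V\<close> and \<open>U\<close>.\<close>
  have "\<iota> (\<one> I) \<otimes>\<^sub>c IU = \<iota> (\<one> (I \<otimes>\<^sub>o I)) \<otimes>\<^sub>c U"
    using D by (simp add: IU_def tensor_id_cell tensor_ident flip: tensor_cell_assoc)
  moreover have "VI \<otimes>\<^sub>c \<iota> (\<one> I) = V \<otimes>\<^sub>c \<iota> (\<one> (I \<otimes>\<^sub>o I))"
    using D by (simp add: VI_def tensor_id_cell tensor_ident tensor_cell_assoc)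
  ultimately have M_eq: "M = (VI \<otimes>\<^sub>c \<iota> (\<one> I)) \<star> IU"
    using whisker_tensor_exchange[OF V(1) U(1)] D by (simp add: M_def IU_def VI_def)
  \<comment> \<open>First factor of the primed composite: interchange splits off \<open>M\<close> in
    the shape \<open>IIU # VI\<close>.\<close>
  have left: "(\<iota> (\<one> I) \<otimes>\<^sub>c inv_cell C l') \<star> r' = (IL \<star> r) \<bullet> M"
  proof -
    have "\<iota> (\<one> I) \<otimes>\<^sub>c inv_cell C l' = IL \<bullet> (\<iota> (\<one> I) \<otimes>\<^sub>c IU)"
      using tensor_vcomp[of "\<iota> (\<one> I)" "inv_cell C l" "\<iota> (\<one> I)" IU] D IU
      by (simp add: IL_def inv_l'_eq)
    then show ?thesis
      using interchange[of IL "\<iota> (\<one> I) \<otimes>\<^sub>c IU" r VI] D IL IU VI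
      by (simp add: r'_eq M_def tensor_obj_assoc)
  qed
  \<comment> \<open>Second factor of the unprimed composite: here \<open>M\<close> splits off in
    front, in the shape \<open>VII # IU\<close>.\<close>
  have right: "(inv_cell C r \<otimes>\<^sub>c \<iota> (\<one> I)) \<star> l = M \<bullet> (RI \<star> l')"
  proof -
    have "inv_cell C r \<otimes>\<^sub>c \<iota> (\<one> I) = (VI \<otimes>\<^sub>c \<iota> (\<one> I)) \<bullet> RI"
      using tensor_vcomp[of VI "\<iota> (\<one> I)" "inv_cell C r'" "\<iota> (\<one> I)"] D VI
      by (simp add: RI_def inv_r_eq)
    then show ?thesis
      using interchange[of "VI \<otimes>\<^sub>c \<iota> (\<one> I)" RI IU l'] D RI IU VI
      by (simp add: l_eq M_eq tensor_obj_assoc)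
  qed
  have "M \<in> Cell C" "csrc C M = ctgt C (IL \<star> r)"
    using D IL IU VI by (simp_all add: M_def tensor_obj_assoc)
  moreover have "ctgt C M = csrc C (RI \<star> l')"
    using D RI IU VI by (simp add: M_eq tensor_obj_assoc)
  moreover have "IL \<star> r \<in> Cell C" "RI \<star> l' \<in> Cell C"
    using D IL RI by (simp_all add: tensor_obj_assoc)
  ultimately show ?thesis
    unfolding associator_composite_def left right by (simp add: vcomp_assoc flip: IL_def RI_def)
qed

end

section \<open>Existence and uniqueness of \<open>A\<close>, and its independence of the
  choices\<close>

theorem proposition3p6:
  fixes C :: "('o, 'a, 'c, 'e) semi_monoidal_scheme"
    and I :: 'o and \<alpha> :: 'a
    and lam lam' rho rho' :: "'o \<Rightarrow> 'a" and L L' R R' :: "'o \<Rightarrow> 'c"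
  assumes "semi_monoidal_2_category C"
    and "unit_object C I \<alpha>"
    and "left_constraint C I \<alpha> lam L" and "right_constraint C I \<alpha> rho R"
    and "left_constraint C I \<alpha> lam' L'" and "right_constraint C I \<alpha> rho' R'"
  shows "(\<exists>!A. associator_eq C I \<alpha> L R A) \<and> (\<exists>!A. associator_eq C I \<alpha> L' R' A) \<and>
    associator C I \<alpha> L R = associator C I \<alpha> L' R'"
proof -
  interpret semi_monoidal_2_category C by fact
  have can: "cancellable C I" and \<alpha>: "\<alpha> \<in> hom C (I \<otimes>\<^sub>o\<^bsub>C\<^esub> I) I" and equi: "equi_arrow C \<alpha>"
    using assms(2) by (auto simp: unit_object_def)
  then have I: "I \<in> Obj C"
    by (simp add: cancellable_def)
  note l = assms(3)[unfolded left_constraint_def, rule_format, OF I]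
    and r = assms(4)[unfolded right_constraint_def, rule_format, OF I]
    and l' = assms(5)[unfolded left_constraint_def, rule_format, OF I]
    and r' = assms(6)[unfolded right_constraint_def, rule_format, OF I]
  have eq: "associator_composite C I (L I) (R I) = associator_composite C I (L' I) (R' I)"
    using associator_composite_cong[OF can \<alpha>] l r l' r' by blast
  have "associator_composite C I (L I) (R I) \<in> cells C
      ((\<one>\<^bsub>C\<^esub> I \<otimes>\<^sub>a\<^bsub>C\<^esub> \<alpha> \<otimes>\<^sub>a\<^bsub>C\<^esub> \<one>\<^bsub>C\<^esub> I) \<odot>\<^bsub>C\<^esub> (\<one>\<^bsub>C\<^esub> I \<otimes>\<^sub>a\<^bsub>C\<^esub> \<alpha>))
      ((\<one>\<^bsub>C\<^esub> I \<otimes>\<^sub>a\<^bsub>C\<^esub> \<alpha> \<otimes>\<^sub>a\<^bsub>C\<^esub> \<one>\<^bsub>C\<^esub> I) \<odot>\<^bsub>C\<^esub> (\<alpha> \<otimes>\<^sub>a\<^bsub>C\<^esub> \<one>\<^bsub>C\<^esub> I))"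
    using associator_composite_cells[OF I \<alpha>] l r by blast
  \<comment> \<open>Whiskering with this arrow is bijective on the relevant 2-cells, so the typed
    composite has exactly one preimage, namely \<open>A\<close>.\<close>
  moreover have "equi_arrow C (\<one>\<^bsub>C\<^esub> I \<otimes>\<^sub>a\<^bsub>C\<^esub> \<alpha> \<otimes>\<^sub>a\<^bsub>C\<^esub> \<one>\<^bsub>C\<^esub> I)"
    by (intro equi_arrow_tensor equi_arrow_ident equi I)
  ultimately have ex1: "\<exists>!A. associator_eq C I \<alpha> L R A"
    unfolding associator_eq_def associator_composite_def[symmetric]
    using I \<alpha> by (intro equi_whisker_ex1) (auto simp: hom_def tensor_obj_assoc)
  \<comment> \<open>The constraints enter the predicate only through the composite, so the two
    predicates coincide. Unique existence carries over to the second choice, and the two definite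
    descriptions agree.\<close>
  have "associator_eq C I \<alpha> L R = associator_eq C I \<alpha> L' R'"
    using eq by (intro ext) (simp add: associator_eq_def flip: associator_composite_def)
  with ex1 show ?thesis
    by (simp add: associator_def)
qed

end
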